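(* For every single-qubit state (density matrix) $\rho$, $$\Lambda^+(\rho)=\Lambda(\rho)=\Xi(\rho),$$ and furthermore $\rho$ admits an equimagical decomposition.
   Context: $\mathrm{S}_n$ denotes the set of pure $n$-qubit stabilizer states (states $|\psi\rangle$ for which there is an abelian subgroup of the $n$-qubit Pauli group with $2^n$ elements all of which fix $|\psi\rangle$); for $n=1$ these are $|0\rangle,|1\rangle,|\pm\rangle,|\pm_i\rangle$. $\bar{\mathrm S}_n=\mathrm{conv}\{|\phi\rangle\langle\phi|:|\phi\rangle\in\mathrm S_n\}$ is the set of mixed stabilizer states. The stabilizer extent of a pure state is $\xi(\Psi)=\min\{\|c\|_1^2: |\Psi\rangle=\sum_j c_j|\phi_j\rangle,\ |\phi_j\rangle\in\mathrm S_n\}$. The mixed-state extent is $\Xi(\rho)=\min\{\sum_j p_j\xi(\Psi_j):\rho=\sum_jp_j|\Psi_j\rangle\langle\Psi_j|\}$, minimum over convex decompositions into pure states; if the minimum is attained by a decomposition in which all $\xi(\Psi_j)$ are equal, $\rho$ is said to admit an equimagical decomposition. The dyadic negativity is $\Lambda(\rho)=\min\{\|\alpha\|_1:\rho=\sum_j\alpha_j|L_j\rangle\langle R_j|,\ |L_j\rangle,|R_j\rangle\in\mathrm S_n,\ \alpha_j\in\mathbb C\}$. The generalized robustness is $\Lambda^+(\rho)=\min\{\lambda:\rho\le\lambda\sigma,\ \sigma\in\bar{\mathrm S}_n\}$, equivalently $\max\{\mathrm{Tr}[W\rho]:W\ge0,\ \langle\phi|W|\phi\rangle\le1\ \forall|\phi\rangle\in\mathrm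 S_n\}$. *)

theory Defs
  imports "HOL-Analysis.Analysis"
begin

type_synonym qket = "complex^2"
type_synonym qop = "complex^2^2"

definition ket :: "complex \<Rightarrow> complex \<Rightarrow> qket" where
  "ket a b = (\<chi> i. if i = 0 then a else b)"

definition cinner :: "qket \<Rightarrow> qket \<Rightarrow> complex" where
  "cinner v w = (\<Sum>i\<in>UNIV. cnj (v $ i) * w $ i)"

definition outer :: "qket \<Rightarrow> qket \<Rightarrow> qop" where
  "outer v w = (\<chi> i j. v $ i * cnj (w $ j))"

definition csmult :: "complex \<Rightarrow> qop \<Rightarrow> qop" where
  "csmult c A = (\<chi> i j. c * A $ i $ j)"

definition adjoint_op :: "qop \<Rightarrow> qop" where
  "adjoint_op A = (\<chi> i j. cnj (A $ j $ i))"

definition mtrace :: "qop \<Rightarrow> complex" where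
  "mtrace A = (\<Sum>i\<in>UNIV. A $ i $ i)"

definition psd :: "qop \<Rightarrow> bool" where
  "psd A \<longleftrightarrow> adjoint_op A = A \<and>
     (\<forall>v. cinner v (A *v v) \<in> \<real> \<and> 0 \<le> Re (cinner v (A *v v)))"

definition density :: "qop \<Rightarrow> bool" where
  "density \<rho> \<longleftrightarrow> psd \<rho> \<and> mtrace \<rho> = 1"

definition stab_kets :: "qket set" where
  "stab_kets = {ket 1 0, ket 0 1,
     ket (1 / sqrt 2) (1 / sqrt 2), ket (1 / sqrt 2) (- 1 / sqrt 2),
     ket (1 / sqrt 2) (\<i> / sqrt 2), ket (1 / sqrt 2) (- \<i> / sqrt 2)}"

definition stab1 :: "qket set" where
  "stab1 = {c *s v | c v. cmod c = 1 \<and> v \<in> stab_kets}"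

definition mixed_stab1 :: "qop set" where
  "mixed_stab1 = convex hull {outer \<phi> \<phi> | \<phi>. \<phi> \<in> stab1}"

definition extent :: "qket \<Rightarrow> real" where
  "extent \<Psi> = Inf {(\<Sum>j\<in>J. cmod (c j))\<^sup>2 | J c \<phi>. finite (J :: nat set) \<and>
      (\<forall>j\<in>J. \<phi> j \<in> stab1) \<and> \<Psi> = (\<Sum>j\<in>J. c j *s \<phi> j)}"

definition pure_decomp :: "qop \<Rightarrow> nat set \<Rightarrow> (nat \<Rightarrow> real) \<Rightarrow> (nat \<Rightarrow> qket) \<Rightarrow> bool" where
  "pure_decomp \<rho> J p \<Psi> \<longleftrightarrow> finite J \<and>
     (\<forall>j\<in>J. 0 < p j \<and> cinner (\<Psi> j) (\<Psi> j) = 1) \<and> (\<Sum>j\<in>J. p j) = 1 \<and>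
     \<rho> = (\<Sum>j\<in>J. p j *\<^sub>R outer (\<Psi> j) (\<Psi> j))"

definition mixed_extent :: "qop \<Rightarrow> real" where
  "mixed_extent \<rho> = Inf {(\<Sum>j\<in>J. p j * extent (\<Psi> j)) | J p \<Psi>. pure_decomp \<rho> J p \<Psi>}"

definition equimagical :: "qop \<Rightarrow> bool" where
  "equimagical \<rho> \<longleftrightarrow> (\<exists>J p \<Psi>. pure_decomp \<rho> J p \<Psi> \<and>
      (\<Sum>j\<in>J. p j * extent (\<Psi> j)) = mixed_extent \<rho> \<and>
      (\<forall>j\<in>J. \<forall>k\<in>J. extent (\<Psi> j) = extent (\<Psi> k)))"

definition dyadic_negativity :: "qop \<Rightarrow> real" where
  "dyadic_negativity \<rho> = Inf {(\<Sum>j\<in>J. cmod (\<alpha> j)) | J \<alpha> L R. finite (J :: nat set) \<and>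
      (\<forall>j\<in>J. L j \<in> stab1 \<and> R j \<in> stab1) \<and>
      \<rho> = (\<Sum>j\<in>J. csmult (\<alpha> j) (outer (L j) (R j)))}"

definition gen_robustness :: "qop \<Rightarrow> real" where
  "gen_robustness \<rho> = Inf {t | t \<sigma>. \<sigma> \<in> mixed_stab1 \<and> psd (t *\<^sub>R \<sigma> - \<rho>)}"

end

theory Submission
  imports Defs
begin

text \<open>
  Let \<open>C\<^sub>t\<close> be the set of states \<open>\<rho> \<le> t \<sigma>\<close> with \<open>\<sigma>\<close> a mixed stabilizer state; it is convex and
  compact. An extreme point \<open>e\<close> of \<open>C\<^sub>t\<close> is pure: if \<open>e\<close> had full rank, then moving \<open>\<sigma>\<close> and \<open>e\<close>
  together shows that \<open>\<sigma>\<close> is itself an extreme point, that is, a pure stabilizer projector, and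
  then \<open>e \<le> t \<sigma>\<close> forces \<open>e\<close> to be singular after all (this is where one uses a single qubit).
  For pure states in \<open>C\<^sub>t\<close> a hyperplane separating \<open>\<Psi> / \<surd>t\<close> from the convex hull of the
  stabilizer kets would give a rank-one witness contradicting \<open>\<Psi>\<Psi>\<^sup>* \<le> t \<sigma>\<close>, so the extent is at
  most \<open>t\<close>. By Krein-Milman, a state of generalized robustness \<open>t\<close> is a mixture of pure states of
  extent at most \<open>t\<close>. Since generalized robustness \<open>\<le>\<close> dyadic negativity \<open>\<le>\<close> average extent
  of any pure decomposition, all these extents must be equal to \<open>t\<close>.
\<close>

section \<open>Two-by-two positive semidefinite matrices\<close>

text \<open>For Hermitian \<open>A\<close> the discarded imaginary part is zero. A real value makes
  the form real-linear in \<open>A\<close> on all operators, so that order arguments and the library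
  facts on \<open>linear\<close> apply.\<close>

definition qform :: "qket \<Rightarrow> qop \<Rightarrow> real" where
  "qform v A = Re (cinner v (A *v v))"

text \<open>The library names the two indices 1 and 2, while \<open>ket\<close> uses 0 and 1. In the
  type \<open>2\<close> the numeral 2 equals 0, which bridges the two conventions.\<close>

lemma sum_index_2: "(\<Sum>i\<in>(UNIV :: 2 set). f i) = f 0 + f 1"
proof -
  have z: "(2::2) = 0" by simp
  show ?thesis unfolding sum_2 z by (rule add.commute)
qed

lemma forall_index_2: "(\<forall>i::2. P i) \<longleftrightarrow> P 0 \<and> P 1"
proof -
  have z: "(2::2) = 0" by simp
  then show ?thesis by (metis exhaust_2)
qed

lemma ket_nth [simp]: "ket a b $ 0 = a" "ket a b $ 1 = b"
  by (simp_all add: ket_def)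

lemma cinner_alt: "cinner v w = cnj (v $ 0) * w $ 0 + cnj (v $ 1) * w $ 1"
  by (simp add: cinner_def sum_index_2)

lemma mtrace_alt: "mtrace A = A $ 0 $ 0 + A $ 1 $ 1"
  by (simp add: mtrace_def sum_index_2)

lemma inner_eq_Re_cinner: "inner v w = Re (cinner v w)" for v w :: qket
  by (simp add: inner_vec_def cinner_alt sum_index_2 inner_complex_def)

lemma outer_nth [simp]: "outer v w $ i $ j = v $ i * cnj (w $ j)"
  by (simp add: outer_def)

lemma csmult_nth [simp]: "csmult c A $ i $ j = c * A $ i $ j"
  by (simp add: csmult_def)

lemma qop_eq_iff:
  "A = B \<longleftrightarrow> A $ 0 $ 0 = B $ 0 $ 0 \<and> A $ 0 $ 1 = B $ 0 $ 1 \<and>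
     A $ 1 $ 0 = B $ 1 $ 0 \<and> A $ 1 $ 1 = B $ 1 $ 1" for A B :: qop
  by (auto simp: vec_eq_iff forall_index_2)

lemma cinner_mult_vec_alt:
  "cinner v (A *v v) = cnj (v $ 0) * A $ 0 $ 0 * v $ 0 + cnj (v $ 0) * A $ 0 $ 1 * v $ 1
     + cnj (v $ 1) * A $ 1 $ 0 * v $ 0 + cnj (v $ 1) * A $ 1 $ 1 * v $ 1"
  by (simp add: cinner_alt matrix_vector_mult_def sum_index_2 algebra_simps)

lemma linear_qform: "linear (qform v)"
  unfolding qform_def cinner_mult_vec_alt by (rule linearI) (auto simp: algebra_simps)

lemma linear_mtrace: "linear mtrace"
  by (rule linearI) (auto simp: mtrace_alt algebra_simps)

lemma qform_outer: "qform v (outer a b) = Re (cinner v a * cnj (cinner v b))"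
  unfolding qform_def cinner_mult_vec_alt by (simp add: cinner_alt algebra_simps)

lemma qform_outer_self: "qform v (outer a a) = (cmod (cinner v a))\<^sup>2"
  by (simp only: qform_outer complex_norm_square[symmetric] Re_complex_of_real)

section \<open>Positivity of a Hermitian matrix read off from its entries\<close>

lemma adjoint_op_eq_iff:
  "adjoint_op A = A \<longleftrightarrow> Im (A $ 0 $ 0) = 0 \<and> Im (A $ 1 $ 1) = 0 \<and> A $ 1 $ 0 = cnj (A $ 0 $ 1)"
  by (auto simp: qop_eq_iff adjoint_op_def complex_eq_iff)

lemma psd_iff_qform: "psd A \<longleftrightarrow> adjoint_op A = A \<and> (\<forall>v. 0 \<le> qform v A)"
  by (auto simp: psd_def qform_def adjoint_op_eq_iff complex_is_Real_iff cinner_mult_vec_alt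
     algebra_simps)

lemma hermitian_qform:
  assumes "adjoint_op A = A"
  shows "qform v A = Re (A $ 0 $ 0) * (cmod (v $ 0))\<^sup>2 + Re (A $ 1 $ 1) * (cmod (v $ 1))\<^sup>2
     + 2 * Re (cnj (v $ 0) * A $ 0 $ 1 * v $ 1)"
  using assms
  by (simp add: adjoint_op_eq_iff qform_def cinner_mult_vec_alt cmod_power2)
     (simp add: algebra_simps power2_eq_square)

text \<open>In size two, positivity amounts to a nonnegative diagonal and determinant. This turns
  closedness, purity and stability under perturbation into inequalities between entries.\<close>

lemma psd_iff:
  "psd A \<longleftrightarrow> adjoint_op A = A \<and> 0 \<le> Re (A $ 0 $ 0) \<and> 0 \<le> Re (A $ 1 $ 1) \<and>
     (cmod (A $ 0 $ 1))\<^sup>2 \<le> Re (A $ 0 $ 0) * Re (A $ 1 $ 1)"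
    (is "_ \<longleftrightarrow> ?H \<and> 0 \<le> ?a \<and> 0 \<le> ?d \<and> (cmod ?b)\<^sup>2 \<le> ?a * ?d")
proof
  assume psd: "psd A"
  then have H: ?H and q: "\<And>v. 0 \<le> qform v A"
    by (auto simp: psd_iff_qform)
  have a: "0 \<le> ?a" using q[of "ket 1 0"] by (simp add: hermitian_qform[OF H])
  have d: "0 \<le> ?d" using q[of "ket 0 1"] by (simp add: hermitian_qform[OF H])
  have b: "(cmod ?b)\<^sup>2 \<le> ?a * ?d"
  proof (cases "?d = 0")
    case True
    \<comment> \<open>With a zero lower diagonal entry, this vector makes the form strictly negative
      unless the off-diagonal entry vanishes.\<close>
    have "0 \<le> qform (ket (- ?b) (complex_of_real (?a + 1))) A" by (rule q)
    also have "\<dots> = - ((?a + 2) * (cmod ?b)\<^sup>2)"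
      unfolding hermitian_qform[OF H] ket_nth norm_mult norm_minus_cancel norm_of_real cmod_power2
      using True by (simp add: algebra_simps power2_eq_square)
    finally have "(?a + 2) * (cmod ?b)\<^sup>2 \<le> 0" by simp
    then show ?thesis using a True by (simp add: mult_le_0_iff)
  next
    case False
    \<comment> \<open>At this vector the form is the determinant times
      \<open>?d * (cmod ?b)\<^sup>2\<close>, a positive factor when \<open>?b\<close> is
      nonzero.\<close>
    have "0 \<le> qform (ket (- ?d * ?b) (complex_of_real ((cmod ?b)\<^sup>2))) A" by (rule q)
    also have "\<dots> = (?d * (cmod ?b)\<^sup>2) * (?a * ?d - (cmod ?b)\<^sup>2)"
      unfolding hermitian_qform[OF H] ket_nth cmod_power2
      by (simp add: algebra_simps power2_eq_square)
    finally have "0 \<le> (?d * (cmod ?b)\<^sup>2) * (?a * ?d - (cmod ?b)\<^sup>2)" .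
    moreover have "0 < ?d * (cmod ?b)\<^sup>2" if "?b \<noteq> 0"
      using d False that by (intro mult_pos_pos) auto
    ultimately show ?thesis using a d by (cases "?b = 0") (auto simp: zero_le_mult_iff)
  qed
  show "?H \<and> 0 \<le> ?a \<and> 0 \<le> ?d \<and> (cmod ?b)\<^sup>2 \<le> ?a * ?d"
    using H a d b by simp
next
  assume R: "?H \<and> 0 \<le> ?a \<and> 0 \<le> ?d \<and> (cmod ?b)\<^sup>2 \<le> ?a * ?d"
  then have H: ?H and a: "0 \<le> ?a" and d: "0 \<le> ?d" and b: "(cmod ?b)\<^sup>2 \<le> ?a * ?d" by auto
  have "0 \<le> qform v A" for v
  proof -
    let ?x = "cmod (v $ 0)" and ?y = "cmod (v $ 1)"
    have "cmod ?b \<le> sqrt ?a * sqrt ?d"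
      using b by (metis real_le_rsqrt real_sqrt_mult)
    then have "?x * cmod ?b * ?y \<le> ?x * (sqrt ?a * sqrt ?d) * ?y"
      by (intro mult_right_mono mult_left_mono) auto
    moreover have "- Re (cnj (v $ 0) * ?b * v $ 1) \<le> ?x * cmod ?b * ?y"
      using abs_Re_le_cmod[of "cnj (v $ 0) * ?b * v $ 1"] by (simp add: norm_mult)
    \<comment> \<open>The determinant bound controls the cross term by twice the product of the two
      roots, so the form is at least this square.\<close>
    moreover have "0 \<le> (sqrt ?a * ?x - sqrt ?d * ?y)\<^sup>2" by simp
    moreover have "(sqrt ?a * ?x - sqrt ?d * ?y)\<^sup>2 = ?a * ?x\<^sup>2 + ?d * ?y\<^sup>2 - 2 * (?x * (sqrt ?a * sqrt ?d) * ?y)"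
      using a d by (simp add: power2_diff power_mult_distrib mult_ac)
    ultimately show ?thesis by (simp add: hermitian_qform[OF H])
  qed
  with H show "psd A" by (simp add: psd_iff_qform)
qed

lemma psd_qform: "psd A \<Longrightarrow> 0 \<le> qform v A"
  by (simp add: psd_iff_qform)

lemma adjoint_op_add: "adjoint_op (A + B) = adjoint_op A + adjoint_op B"
  and adjoint_op_diff: "adjoint_op (A - B) = adjoint_op A - adjoint_op B"
  and adjoint_op_scaleR: "adjoint_op (r *\<^sub>R A) = r *\<^sub>R adjoint_op A"
  by (simp_all add: qop_eq_iff adjoint_op_def)

lemma psd_add: "psd A \<Longrightarrow> psd B \<Longrightarrow> psd (A + B)"
  by (simp add: psd_iff_qform adjoint_op_add linear_add[OF linear_qform])

lemma psd_scaleR: "psd A \<Longrightarrow> 0 \<le> r \<Longrightarrow> psd (r *\<^sub>R A)"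
  by (simp add: psd_iff_qform adjoint_op_scaleR linear_cmul[OF linear_qform])

lemma psd_outer: "psd (outer a a)"
  by (auto simp: psd_iff_qform qform_outer_self qop_eq_iff adjoint_op_def)

lemma closed_psd: "closed {A. psd A}"
  unfolding psd_iff adjoint_op_eq_iff
  by (intro closed_Collect_conj closed_Collect_eq closed_Collect_le continuous_intros)

section \<open>Density matrices: convexity, compactness, rank one and full rank\<close>

lemma mtrace_psd: "psd A \<Longrightarrow> Im (mtrace A) = 0 \<and> 0 \<le> Re (mtrace A)"
  by (auto simp: psd_iff mtrace_alt adjoint_op_eq_iff)

lemma density_outer: "cinner v v = 1 \<Longrightarrow> density (outer v v)"
  by (simp add: density_def psd_outer mtrace_alt cinner_alt mult.commute)

lemma convex_density: "convex {\<rho>. density \<rho>}"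
proof (rule convexI)
  fix x y :: qop and u v :: real
  assume "x \<in> {\<rho>. density \<rho>}" "y \<in> {\<rho>. density \<rho>}" and uv: "0 \<le> u" "0 \<le> v" "u + v = 1"
  then have "psd (u *\<^sub>R x + v *\<^sub>R y)" "mtrace (u *\<^sub>R x + v *\<^sub>R y) = 1"
    by (simp_all add: density_def psd_add psd_scaleR linear_add[OF linear_mtrace]
        linear_cmul[OF linear_mtrace] complex_eq_iff)
  with uv show "u *\<^sub>R x + v *\<^sub>R y \<in> {\<rho>. density \<rho>}" by (simp add: density_def)
qed

lemma compact_density: "compact {\<rho>. density \<rho>}"
proof -
  have "closed {\<rho>. density \<rho>}"
    unfolding density_def mtrace_alt
    by (intro closed_Collect_conj closed_psd closed_Collect_eq continuous_intros)
  moreover have "norm \<rho> \<le> 4" if "density \<rho>" for \<rho>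
  proof -
    have r: "Im (\<rho> $ 0 $ 0) = 0" "Im (\<rho> $ 1 $ 1) = 0" "\<rho> $ 1 $ 0 = cnj (\<rho> $ 0 $ 1)"
       "0 \<le> Re (\<rho> $ 0 $ 0)" "0 \<le> Re (\<rho> $ 1 $ 1)"
       "(cmod (\<rho> $ 0 $ 1))\<^sup>2 \<le> Re (\<rho> $ 0 $ 0) * Re (\<rho> $ 1 $ 1)"
       "\<rho> $ 0 $ 0 + \<rho> $ 1 $ 1 = 1"
      using that by (auto simp: density_def psd_iff adjoint_op_eq_iff mtrace_alt)
    have s: "Re (\<rho> $ 0 $ 0) + Re (\<rho> $ 1 $ 1) = 1"
      using r(7) by (simp add: complex_eq_iff)
    have "Re (\<rho> $ 0 $ 0) * Re (\<rho> $ 1 $ 1) \<le> 1 * 1"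
      using r(4,5) s by (intro mult_mono) auto
    then have "cmod (\<rho> $ 0 $ 1) \<le> 1"
      using r(6) power2_le_imp_le[of "cmod (\<rho> $ 0 $ 1)" 1] by simp
    moreover have "cmod (\<rho> $ 0 $ 0) \<le> 1" "cmod (\<rho> $ 1 $ 1) \<le> 1"
      using r(1,2,4,5) s by (simp_all add: cmod_eq_Re)
    ultimately have e: "cmod (\<rho> $ i $ j) \<le> 1" for i j
      using forall_index_2[of "\<lambda>i. cmod (\<rho> $ i $ j) \<le> 1"]
        forall_index_2[of "\<lambda>j. cmod (\<rho> $ 0 $ j) \<le> 1"]
        forall_index_2[of "\<lambda>j. cmod (\<rho> $ 1 $ j) \<le> 1"] r(3)
      by auto
    have "norm \<rho> \<le> (\<Sum>i\<in>UNIV. norm (\<rho> $ i))" by (simp add: norm_vec_def L2_set_le_sum)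
    also have "\<dots> \<le> (\<Sum>i\<in>UNIV. \<Sum>j\<in>UNIV. cmod (\<rho> $ i $ j))"
      by (intro sum_mono) (simp add: norm_vec_def L2_set_le_sum)
    also have "\<dots> \<le> (\<Sum>i\<in>(UNIV::2 set). \<Sum>j\<in>(UNIV::2 set). 1)"
      by (intro sum_mono e)
    finally show ?thesis by simp
  qed
  then have "bounded {\<rho>. density \<rho>}" by (auto simp: bounded_iff)
  ultimately show ?thesis by (simp add: compact_eq_bounded_closed)
qed

lemma rank_one_density:
  assumes "density \<rho>" and det: "Re (\<rho> $ 0 $ 0) * Re (\<rho> $ 1 $ 1) = (cmod (\<rho> $ 0 $ 1))\<^sup>2"
  obtains \<Psi> where "cinner \<Psi> \<Psi> = 1" "\<rho> = outer \<Psi> \<Psi>"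
proof -
  define a d b where "a = Re (\<rho> $ 0 $ 0)" and "d = Re (\<rho> $ 1 $ 1)" and "b = \<rho> $ 0 $ 1"
  have \<rho>: "\<rho> $ 0 $ 0 = a" "\<rho> $ 1 $ 1 = d" "\<rho> $ 0 $ 1 = b" "\<rho> $ 1 $ 0 = cnj b"
    and ad: "0 \<le> a" "0 \<le> d" "a + d = 1" "a * d = (cmod b)\<^sup>2"
    using assms by (auto simp: density_def psd_iff adjoint_op_eq_iff mtrace_alt complex_eq_iff
       a_def d_def b_def)
  have bb: "b * cnj b = a * d"
    by (simp only: complex_norm_square[symmetric] ad(4)[symmetric] of_real_mult)
  \<comment> \<open>The vector is the first column of \<rho> divided by \<open>sqrt a\<close>. If
    \<open>a = 0\<close>, the zero determinant also kills the off-diagonal entries, leaving the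
    projector on the second basis ket.\<close>
  define \<Psi> where "\<Psi> = (if a = 0 then ket 0 1 else ket (sqrt a) (cnj b / sqrt a))"
  have s: "complex_of_real (sqrt a) * complex_of_real (sqrt a) = a"
    using ad by (simp flip: of_real_mult)
  have \<Psi>: "\<rho> = outer \<Psi> \<Psi>"
  proof (cases "a = 0")
    case True
    then show ?thesis using ad by (simp add: qop_eq_iff \<rho> \<Psi>_def)
  next
    case False
    have "cnj b / complex_of_real (sqrt a) * cnj (cnj b / complex_of_real (sqrt a))
        = (b * cnj b) / (complex_of_real (sqrt a) * complex_of_real (sqrt a))"
      by simp
    also have "\<dots> = d" unfolding bb s using False by simp
    finally show ?thesis using False s by (simp add: qop_eq_iff \<rho> \<Psi>_def)
  qed
  moreover have "cinner \<Psi> \<Psi> = mtrace \<rho>"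
    by (simp add: \<Psi> cinner_alt mtrace_alt mult.commute)
  ultimately show ?thesis using that assms(1) by (simp add: density_def)
qed

text \<open>Positive determinant puts \<open>A\<close> in the interior of the positive cone:
  diagonal entries and determinant are continuous in \<epsilon>, so they stay positive for small
  \<epsilon>.\<close>

lemma psd_perturb:
  assumes "psd A" "(cmod (A $ 0 $ 1))\<^sup>2 < Re (A $ 0 $ 0) * Re (A $ 1 $ 1)" "adjoint_op H = H"
  shows "\<forall>\<^sub>F \<epsilon> in at_right 0. psd (A + \<epsilon> *\<^sub>R H)"
proof -
  have "0 \<le> Re (A $ 0 $ 0)" "0 \<le> Re (A $ 1 $ 1)" "adjoint_op A = A"
    using assms(1) by (auto simp: psd_iff)
  moreover have "0 < Re (A $ 0 $ 0) * Re (A $ 1 $ 1)"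
    using assms(2) by (rule le_less_trans[rotated]) simp
  ultimately have pos: "0 < Re (A $ 0 $ 0)" "0 < Re (A $ 1 $ 1)"
    by (auto simp: zero_less_mult_iff)
  let ?B = "\<lambda>\<epsilon>::real. A + \<epsilon> *\<^sub>R H"
  have "((\<lambda>\<epsilon>. ?B \<epsilon> $ i $ j) \<longlongrightarrow> A $ i $ j) (at_right 0)" for i j
    by (auto intro!: tendsto_eq_intros)
  note lim = this tendsto_Re[OF this]
  have "\<forall>\<^sub>F \<epsilon> in at_right 0. 0 < Re (?B \<epsilon> $ 0 $ 0)"
    by (rule order_tendstoD(1)[OF lim(2) pos(1)])
  moreover have "\<forall>\<^sub>F \<epsilon> in at_right 0. 0 < Re (?B \<epsilon> $ 1 $ 1)"
    by (rule order_tendstoD(1)[OF lim(2) pos(2)])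
  moreover have "((\<lambda>\<epsilon>. Re (?B \<epsilon> $ 0 $ 0) * Re (?B \<epsilon> $ 1 $ 1) - (cmod (?B \<epsilon> $ 0 $ 1))\<^sup>2)
      \<longlongrightarrow> Re (A $ 0 $ 0) * Re (A $ 1 $ 1) - (cmod (A $ 0 $ 1))\<^sup>2) (at_right 0)"
    by (intro tendsto_intros lim)
  then have "\<forall>\<^sub>F \<epsilon> in at_right 0.
      0 < Re (?B \<epsilon> $ 0 $ 0) * Re (?B \<epsilon> $ 1 $ 1) - (cmod (?B \<epsilon> $ 0 $ 1))\<^sup>2"
    by (rule order_tendstoD(1)) (use assms(2) in simp)
  ultimately show ?thesis
  proof eventually_elim
    case (elim \<epsilon>)
    then show ?case
      using \<open>adjoint_op A = A\<close> assms(3) by (simp add: psd_iff adjoint_op_add adjoint_op_scaleR)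
  qed
qed

section \<open>Mixed stabilizer states and generalized robustness\<close>

lemma finite_stab_kets: "finite stab_kets"
  by (simp add: stab_kets_def)

lemma stab_kets_normalized: "v \<in> stab_kets \<Longrightarrow> cinner v v = 1"
  by (auto simp: stab_kets_def cinner_alt simp flip: of_real_mult)

lemma stab_kets_subset: "stab_kets \<subseteq> stab1"
proof
  fix v assume "v \<in> stab_kets"
  then show "v \<in> stab1"
    unfolding stab1_def by (intro CollectI exI[of _ 1] exI[of _ v]) simp
qed

lemma ket_basis_stab1: "ket 1 0 \<in> stab1" "ket 0 1 \<in> stab1"
  using stab_kets_subset by (auto simp: stab_kets_def)

lemma cinner_scale_left: "cinner (c *s v) w = cnj c * cinner v w"
  and cinner_scale_right: "cinner v (c *s w) = c * cinner v w"
  by (simp_all add: cinner_alt algebra_simps)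

lemma stab1_scale: "cmod c = 1 \<Longrightarrow> v \<in> stab1 \<Longrightarrow> c *s v \<in> stab1"
  unfolding stab1_def by (auto simp: vector_smult_assoc) (metis mult_1 norm_mult)

lemma stab1_normalized:
  assumes "v \<in> stab1"
  shows "cinner v v = 1"
proof -
  obtain c w where "v = c *s w" and c: "cmod c = 1" and w: "w \<in> stab_kets"
    using assms by (auto simp: stab1_def)
  then have "cinner v v = c * cnj c * cinner w w"
    by (simp add: cinner_scale_left cinner_scale_right)
  then show ?thesis
    using c w by (simp add: stab_kets_normalized flip: complex_norm_square)
qed

text \<open>The free phase makes the set infinite, but it is a finite union of continuous images of
  the unit circle.\<close>

lemma compact_stab1: "compact stab1"
proof -
  have eq: "stab1 = (\<Union>v\<in>stab_kets. (\<lambda>c. c *s v) ` sphere 0 1)"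
    unfolding stab1_def by fastforce
  have "continuous_on (sphere 0 1) (\<lambda>c. c *s v)" for v :: qket
    unfolding vector_scalar_mult_def by (intro continuous_intros)
  then show ?thesis
    unfolding eq using finite_stab_kets
    by (intro compact_UN ballI compact_continuous_image compact_sphere)
qed

lemma convex_mixed_stab1: "convex mixed_stab1"
  by (simp add: mixed_stab1_def)

lemma outer_mixed_stab1: "\<phi> \<in> stab1 \<Longrightarrow> outer \<phi> \<phi> \<in> mixed_stab1"
  unfolding mixed_stab1_def by (rule hull_inc) auto

lemma compact_mixed_stab1: "compact mixed_stab1"
proof -
  have "continuous_on stab1 (\<lambda>\<phi>. outer \<phi> \<phi>)"
    unfolding outer_def by (intro continuous_intros)
  then have "compact ((\<lambda>\<phi>. outer \<phi> \<phi>) ` stab1)"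
    by (rule compact_continuous_image[OF _ compact_stab1])
  then show ?thesis
    unfolding mixed_stab1_def by (simp add: compact_convex_hull Setcompr_eq_image)
qed

lemma density_mixed_stab1: "\<sigma> \<in> mixed_stab1 \<Longrightarrow> density \<sigma>"
proof -
  have "mixed_stab1 \<subseteq> {\<rho>. density \<rho>}"
    unfolding mixed_stab1_def
    by (rule hull_minimal) (auto simp: convex_density density_outer stab1_normalized)
  then show "\<sigma> \<in> mixed_stab1 \<Longrightarrow> density \<sigma>" by blast
qed

section \<open>The sets \<open>C_t\<close> of the opening text, here
  \<open>robust_feasible t\<close>\<close>

definition robust_feasible :: "real \<Rightarrow> qop set" where
  "robust_feasible t = {\<rho>. density \<rho> \<and> (\<exists>\<sigma>\<in>mixed_stab1. psd (t *\<^sub>R \<sigma> - \<rho>))}"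

text \<open>The trace of the positive matrix \<open>t *\<^sub>R \<sigma> - \<rho>\<close> is
  \<open>t - 1\<close>.\<close>

lemma robust_feasible_ge_1:
  assumes "density \<rho>" "\<sigma> \<in> mixed_stab1" "psd (t *\<^sub>R \<sigma> - \<rho>)"
  shows "1 \<le> t"
proof -
  have "0 \<le> Re (mtrace (t *\<^sub>R \<sigma> - \<rho>))" using assms(3) mtrace_psd by blast
  moreover have "mtrace \<sigma> = 1" "mtrace \<rho> = 1"
    using assms density_mixed_stab1 by (auto simp: density_def)
  ultimately show ?thesis
    by (simp add: linear_diff[OF linear_mtrace] linear_cmul[OF linear_mtrace])
qed

text \<open>Twice the maximally mixed state is the identity. Subtracting a trace-one \<rho> from it
  swaps the diagonal entries and negates the off-diagonal ones, so the determinant is kept.\<close>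

lemma robust_feasible_2:
  assumes "density \<rho>"
  obtains \<sigma> where "\<sigma> \<in> mixed_stab1" "psd (2 *\<^sub>R \<sigma> - \<rho>)"
proof
  let ?\<sigma> = "(1/2) *\<^sub>R outer (ket 1 0) (ket 1 0) + (1/2) *\<^sub>R outer (ket 0 1) (ket 0 1)"
  show "?\<sigma> \<in> mixed_stab1"
    by (rule convexD[OF convex_mixed_stab1]) (auto simp: outer_mixed_stab1 ket_basis_stab1)
  have tr: "\<rho> $ 0 $ 0 = 1 - \<rho> $ 1 $ 1"
    using assms by (simp add: density_def mtrace_alt eq_diff_eq)
  show "psd (2 *\<^sub>R ?\<sigma> - \<rho>)"
    using assms unfolding density_def psd_iff adjoint_op_eq_iff
    by (simp add: tr mult.commute)
qed

lemma gen_robustness_attained: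
  assumes "density \<rho>"
  shows "\<rho> \<in> robust_feasible (gen_robustness \<rho>)"
    and "\<And>t \<sigma>. \<sigma> \<in> mixed_stab1 \<Longrightarrow> psd (t *\<^sub>R \<sigma> - \<rho>) \<Longrightarrow> gen_robustness \<rho> \<le> t"
proof -
  let ?T = "{t | t \<sigma>. \<sigma> \<in> mixed_stab1 \<and> psd (t *\<^sub>R \<sigma> - \<rho>)}"
  have bdd: "bdd_below ?T"
    using robust_feasible_ge_1[OF assms] by (auto intro!: bdd_belowI[of _ 1])
  then show le: "\<And>t \<sigma>. \<sigma> \<in> mixed_stab1 \<Longrightarrow> psd (t *\<^sub>R \<sigma> - \<rho>) \<Longrightarrow> gen_robustness \<rho> \<le> t"
    unfolding gen_robustness_def by (rule cInf_lower[rotated]) blast+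
  \<comment> \<open>Factors \<open>t\<close> lie above 1, and 2 is always feasible, so the minimum
    can be sought on this compact set of pairs. Candidates above 2 are compared with the pair at 2
    afterwards.\<close>
  let ?K = "({1..2} \<times> mixed_stab1) \<inter> {x. psd (fst x *\<^sub>R snd x - \<rho>)}"
  have "closed ((\<lambda>x. fst x *\<^sub>R snd x - \<rho>) -` {A. psd A})"
    by (rule closed_vimage[OF closed_psd]) (intro continuous_intros)
  then have "compact ?K"
    by (intro compact_Int_closed compact_Times compact_mixed_stab1) (auto simp: vimage_def)
  moreover obtain \<sigma>\<^sub>0 where "\<sigma>\<^sub>0 \<in> mixed_stab1" "psd (2 *\<^sub>R \<sigma>\<^sub>0 - \<rho>)"
    using robust_feasible_2[OF assms] .
  then have ne: "(2, \<sigma>\<^sub>0) \<in> ?K" by simp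
  moreover have "continuous_on ?K fst"
    by (rule continuous_on_fst[OF continuous_on_id])
  ultimately obtain x where x: "x \<in> ?K" and min: "\<And>y. y \<in> ?K \<Longrightarrow> fst x \<le> fst y"
    using continuous_attains_inf[of ?K fst] by (metis (no_types, lifting) empty_iff)
  have "fst x \<le> t" if "t \<in> ?T" for t
  proof -
    from that obtain \<sigma> where \<sigma>: "\<sigma> \<in> mixed_stab1" "psd (t *\<^sub>R \<sigma> - \<rho>)" by auto
    have "fst x \<le> 2" using min[OF ne] by simp
    moreover have "fst x \<le> t" if "t \<le> 2"
      using \<sigma> robust_feasible_ge_1[OF assms \<sigma>] that min[of "(t, \<sigma>)"] by simp
    ultimately show ?thesis by linarith
  qed
  then have "fst x \<le> gen_robustness \<rho>"
    unfolding gen_robustness_def using x by (intro cInf_greatest[of ?T]) (auto simp: mem_Times_iff)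
  moreover have "gen_robustness \<rho> \<le> fst x"
    using x by (intro le[of "snd x"]) (auto simp: mem_Times_iff)
  ultimately show "\<rho> \<in> robust_feasible (gen_robustness \<rho>)"
    using x assms by (auto simp: robust_feasible_def mem_Times_iff)
qed

lemma convex_robust_feasible: "convex (robust_feasible t)"
proof (rule convexI)
  fix x y and u v :: real
  assume "x \<in> robust_feasible t" "y \<in> robust_feasible t" and uv: "0 \<le> u" "0 \<le> v" "u + v = 1"
  then obtain \<sigma> \<tau> where *: "density x" "density y" "\<sigma> \<in> mixed_stab1" "\<tau> \<in> mixed_stab1"
      "psd (t *\<^sub>R \<sigma> - x)" "psd (t *\<^sub>R \<tau> - y)"
    by (auto simp: robust_feasible_def)
  have "t *\<^sub>R (u *\<^sub>R \<sigma> + v *\<^sub>R \<tau>) - (u *\<^sub>R x + v *\<^sub>R y)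
      = u *\<^sub>R (t *\<^sub>R \<sigma> - x) + v *\<^sub>R (t *\<^sub>R \<tau> - y)"
    by (simp add: algebra_simps)
  then have "psd (t *\<^sub>R (u *\<^sub>R \<sigma> + v *\<^sub>R \<tau>) - (u *\<^sub>R x + v *\<^sub>R y))"
    using * uv by (simp add: psd_add psd_scaleR)
  moreover have "u *\<^sub>R \<sigma> + v *\<^sub>R \<tau> \<in> mixed_stab1"
    using * uv by (intro convexD[OF convex_mixed_stab1])
  moreover have "density (u *\<^sub>R x + v *\<^sub>R y)"
    using convexD[OF convex_density, of x y u v] * uv by simp
  ultimately show "u *\<^sub>R x + v *\<^sub>R y \<in> robust_feasible t"
    by (auto simp: robust_feasible_def)
qed

text \<open>The set is the projection of a compact set of pairs consisting of a mixed stabilizer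
  state and a density matrix.\<close>

lemma compact_robust_feasible: "compact (robust_feasible t)"
proof -
  let ?K = "(mixed_stab1 \<times> {\<rho>. density \<rho>}) \<inter> {x. psd (t *\<^sub>R fst x - snd x)}"
  have "closed ((\<lambda>x. t *\<^sub>R fst x - snd x) -` {A. psd A})"
    by (rule closed_vimage[OF closed_psd]) (intro continuous_intros)
  then have "compact ?K"
    by (intro compact_Int_closed compact_Times compact_mixed_stab1 compact_density)
       (auto simp: vimage_def)
  moreover have "robust_feasible t = snd ` ?K"
    by (force simp: robust_feasible_def)
  ultimately show ?thesis
    by (simp add: compact_continuous_image continuous_on_snd continuous_on_id)
qed

section \<open>Purity of the extreme points of \<open>C_t\<close>\<close>

lemma cinner_orthogonal_ket: "cinner (ket (- cnj (v $ 1)) (cnj (v $ 0))) v = 0"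
  by (simp add: cinner_alt mult.commute)

lemma extreme_point_robust_feasible_pure:
  assumes "e extreme_point_of robust_feasible t"
  obtains \<Psi> where "cinner \<Psi> \<Psi> = 1" "e = outer \<Psi> \<Psi>"
proof -
  have "e \<in> robust_feasible t" using assms by (simp add: extreme_point_of_def)
  then obtain \<sigma> where e: "density e" and \<sigma>: "\<sigma> \<in> mixed_stab1" "psd (t *\<^sub>R \<sigma> - e)"
    by (auto simp: robust_feasible_def)
  have t: "1 \<le> t" using robust_feasible_ge_1[OF e \<sigma>] .
  have psd_e: "psd e" using e by (simp add: density_def)
  let ?det = "Re (e $ 0 $ 0) * Re (e $ 1 $ 1) - (cmod (e $ 0 $ 1))\<^sup>2"
  have "\<not> 0 < ?det"
  proof
    assume "0 < ?det"
    then have det: "(cmod (e $ 0 $ 1))\<^sup>2 < Re (e $ 0 $ 0) * Re (e $ 1 $ 1)" by simp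
    have "\<sigma> extreme_point_of mixed_stab1"
      unfolding extreme_point_of_def
    proof (intro conjI ballI notI)
      fix a b assume ab: "a \<in> mixed_stab1" "b \<in> mixed_stab1" "\<sigma> \<in> open_segment a b"
      then obtain u where u: "a \<noteq> b" "0 < u" "u < 1" "\<sigma> = (1 - u) *\<^sub>R a + u *\<^sub>R b"
        by (auto simp: in_segment)
      \<comment> \<open>As \<sigma> slides along the segment from \<open>a\<close> to
        \<open>b\<close>, this is the traceless direction in which \<open>e\<close> must move to
        leave \<open>t *\<^sub>R \<sigma> - e\<close> unchanged.\<close>
      define H where "H = t *\<^sub>R (b - a)"
      have ab_herm: "adjoint_op a = a" "adjoint_op b = b" and ab_tr: "mtrace a = 1" "mtrace b = 1"
        using density_mixed_stab1 ab by (auto simp: density_def psd_def)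
      have H: "adjoint_op H = H"
        by (simp add: H_def adjoint_op_scaleR adjoint_op_diff ab_herm)
      then have mH: "adjoint_op (- H) = - H"
        using adjoint_op_scaleR[of "-1" H] by simp
      have "\<forall>\<^sub>F \<epsilon> in at_right 0. \<epsilon> \<in> {0<..<min u (1 - u)}"
        using u by (intro eventually_at_right_real) auto
      with psd_perturb[OF psd_e det H] psd_perturb[OF psd_e det mH]
      have "\<forall>\<^sub>F \<epsilon> in at_right 0. psd (e + \<epsilon> *\<^sub>R H) \<and> psd (e + \<epsilon> *\<^sub>R - H) \<and> \<epsilon> \<in> {0<..<min u (1 - u)}"
        by (intro eventually_conj)
      then obtain \<epsilon> where \<epsilon>: "psd (e + \<epsilon> *\<^sub>R H)" "psd (e - \<epsilon> *\<^sub>R H)" "0 < \<epsilon>" "\<epsilon> < u" "\<epsilon> < 1 - u"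
        using eventually_happens'[OF trivial_limit_at_right_real] by fastforce
      \<comment> \<open>A signed \<open>r\<close> serves both directions. The bounds on \<epsilon>
        keep the shifted weights in the unit interval, so the shifted \<sigma> is still a mixed
        stabilizer state.\<close>
      have mem: "e + r *\<^sub>R H \<in> robust_feasible t" if "psd (e + r *\<^sub>R H)" "\<bar>r\<bar> \<le> \<epsilon>" for r
      proof -
        have "mtrace (e + r *\<^sub>R H) = 1"
          using e ab_tr by (simp add: density_def H_def linear_add[OF linear_mtrace]
              linear_cmul[OF linear_mtrace] linear_diff[OF linear_mtrace])
        moreover have "(1 - (u + r)) *\<^sub>R a + (u + r) *\<^sub>R b \<in> mixed_stab1"
          using ab that \<epsilon> by (intro convexD[OF convex_mixed_stab1]) auto
        moreover have "t *\<^sub>R ((1 - (u + r)) *\<^sub>R a + (u + r) *\<^sub>R b) - (e + r *\<^sub>R H) = t *\<^sub>R \<sigma> - e"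
          by (simp add: u(4) H_def algebra_simps)
        ultimately show ?thesis
          using that(1) \<sigma>(2) unfolding robust_feasible_def density_def
          by (intro CollectI conjI bexI[of _ "(1 - (u + r)) *\<^sub>R a + (u + r) *\<^sub>R b"]) (simp_all only:)
      qed
      have plus_minus: "e + \<epsilon> *\<^sub>R H \<in> robust_feasible t" "e + (- \<epsilon>) *\<^sub>R H \<in> robust_feasible t"
        using \<epsilon> by (intro mem; simp)+
      have "H \<noteq> 0" using u t by (simp add: H_def)
      then have "e + \<epsilon> *\<^sub>R H \<noteq> e + (- \<epsilon>) *\<^sub>R H" using \<epsilon>(3)
        unfolding add_left_cancel scaleR_cancel_right by simp
      moreover have "midpoint (e + \<epsilon> *\<^sub>R H) (e + (- \<epsilon>) *\<^sub>R H) = e"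
        by (simp add: midpoint_eq_iff scaleR_2)
      ultimately have "e \<in> open_segment (e + \<epsilon> *\<^sub>R H) (e + (- \<epsilon>) *\<^sub>R H)"
        by (metis midpoint_in_open_segment)
      then show False
        using assms plus_minus by (auto simp: extreme_point_of_def)
    qed (fact \<sigma>(1))
    then obtain \<phi> where \<phi>: "\<phi> \<in> stab1" "\<sigma> = outer \<phi> \<phi>"
      unfolding mixed_stab1_def using extreme_point_of_convex_hull by blast
    \<comment> \<open>The ket orthogonal to \<phi>: since \<sigma> vanishes on it, domination by
      \<open>t *\<^sub>R \<sigma>\<close> leaves no room for \<open>e\<close> to be positive
      there.\<close>
    define v where "v = ket (- cnj (\<phi> $ 1)) (cnj (\<phi> $ 0))"
    have "0 \<le> qform v (t *\<^sub>R \<sigma> - e)" using \<sigma>(2) by (rule psd_qform)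
    also have "\<dots> = - qform v e"
      by (simp add: \<phi>(2) linear_diff[OF linear_qform] linear_cmul[OF linear_qform]
          qform_outer_self v_def cinner_orthogonal_ket)
    finally have v: "qform v e \<le> 0" by simp
    have "cinner v v = 1" using stab1_normalized[OF \<phi>(1)]
      by (simp add: v_def cinner_alt algebra_simps)
    \<comment> \<open>A full-rank \<open>e\<close> would remain positive after subtracting a small
      multiple of this projector, yet its form at \<open>v\<close> would become negative.\<close>
    have "adjoint_op (- outer v v) = - outer v v"
      by (simp add: qop_eq_iff adjoint_op_def)
    from psd_perturb[OF psd_e det this]
    have "\<forall>\<^sub>F \<epsilon> in at_right 0. psd (e + \<epsilon> *\<^sub>R - outer v v) \<and> \<epsilon> \<in> {0<..<(1::real)}"
      by (intro eventually_conj eventually_at_right_real) auto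
    then obtain \<epsilon> :: real where "psd (e + \<epsilon> *\<^sub>R - outer v v)" "0 < \<epsilon>"
      using eventually_happens'[OF trivial_limit_at_right_real] by fastforce
    moreover have "qform v (e + \<epsilon> *\<^sub>R - outer v v) = qform v e - \<epsilon>"
      using \<open>cinner v v = 1\<close>
      by (simp add: linear_diff[OF linear_qform] linear_cmul[OF linear_qform] qform_outer_self)
    ultimately show False using v psd_qform[of "e + \<epsilon> *\<^sub>R - outer v v" v] by simp
  qed
  moreover have "0 \<le> ?det" using psd_e by (simp add: psd_iff)
  ultimately have "?det = 0" by linarith
  then show ?thesis using rank_one_density[OF e] that by auto
qed

section \<open>Extent and dyadic negativity\<close>

text \<open>Minkowski's theorem for a compact convex set writes \<rho> as a finite mixture of
  extreme points, all of which are pure members of the same set.\<close>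

lemma robust_feasible_pure_decomp:
  assumes "\<rho> \<in> robust_feasible t"
  obtains J p \<Psi> where "pure_decomp \<rho> J p \<Psi>" "\<forall>j\<in>J. outer (\<Psi> j) (\<Psi> j) \<in> robust_feasible t"
proof -
  let ?E = "{e. e extreme_point_of robust_feasible t}"
  have "\<rho> \<in> convex hull ?E"
    using assms Krein_Milman_Minkowski[OF compact_robust_feasible convex_robust_feasible, of t] by simp
  then obtain k :: nat and u x where x: "\<And>i. i \<in> {1..k} \<Longrightarrow> 0 \<le> u i \<and> x i \<in> ?E"
    and u: "sum u {1..k} = 1" and \<rho>: "(\<Sum>i = 1..k. u i *\<^sub>R x i) = \<rho>"
    unfolding convex_hull_indexed by blast
  have "\<exists>\<Psi>. cinner \<Psi> \<Psi> = 1 \<and> x i = outer \<Psi> \<Psi>" if "i \<in> {1..k}" for i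
    using extreme_point_robust_feasible_pure[of "x i" t] x[OF that] by blast
  then obtain \<Psi> where \<Psi>: "\<And>i. i \<in> {1..k} \<Longrightarrow> cinner (\<Psi> i) (\<Psi> i) = 1 \<and> x i = outer (\<Psi> i) (\<Psi> i)"
    by metis
  \<comment> \<open>Zero weights are dropped because \<open>pure_decomp\<close> asks for strictly
    positive ones.\<close>
  define J where "J = {i \<in> {1..k}. u i \<noteq> 0}"
  have J: "J \<subseteq> {1..k}" by (auto simp: J_def)
  show ?thesis
  proof
    have "sum u J = sum u {1..k}"
      by (rule sum.mono_neutral_left) (auto simp: J_def)
    moreover have "(\<Sum>i\<in>J. u i *\<^sub>R outer (\<Psi> i) (\<Psi> i)) = (\<Sum>i\<in>J. u i *\<^sub>R x i)"
      using J \<Psi> by (intro sum.cong) auto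
    moreover have "(\<Sum>i\<in>J. u i *\<^sub>R x i) = (\<Sum>i = 1..k. u i *\<^sub>R x i)"
      by (rule sum.mono_neutral_left) (auto simp: J_def)
    moreover have "0 < u i" if "i \<in> J" for i
      using that x[of i] by (auto simp: J_def)
    ultimately show "pure_decomp \<rho> J u \<Psi>"
      unfolding pure_decomp_def using u \<rho> \<Psi> J finite_subset[OF J] by auto
  next
    show "\<forall>j\<in>J. outer (\<Psi> j) (\<Psi> j) \<in> robust_feasible t"
    proof
      fix j assume "j \<in> J"
      then have "j \<in> {1..k}" using J by blast
      then show "outer (\<Psi> j) (\<Psi> j) \<in> robust_feasible t"
        using x[of j] \<Psi>[of j] by (simp add: extreme_point_of_def)
    qed
  qed
qed

lemma extent_le:
  assumes "finite (J :: nat set)" "\<And>j. j \<in> J \<Longrightarrow> \<phi> j \<in> stab1" "\<Psi> = (\<Sum>j\<in>J. c j *s \<phi> j)"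
  shows "extent \<Psi> \<le> (\<Sum>j\<in>J. cmod (c j))\<^sup>2"
  unfolding extent_def
  by (rule cInf_lower) (use assms in \<open>auto intro!: bdd_belowI[of _ 0]\<close>)

lemma extent_le_of_robust_feasible:
  assumes "outer \<Psi> \<Psi> \<in> robust_feasible t"
  shows "extent \<Psi> \<le> t"
proof -
  obtain \<sigma> where \<sigma>: "\<sigma> \<in> mixed_stab1" "psd (t *\<^sub>R \<sigma> - outer \<Psi> \<Psi>)" and t: "1 \<le> t"
    using assms robust_feasible_ge_1 by (auto simp: robust_feasible_def)
  \<comment> \<open>Membership of \<open>z\<close> in the hull of the stabilizer kets is the goal:
    convex weights rescaled by \<open>sqrt t\<close> are coefficients with squared 1-norm equal to
    \<open>t\<close>.\<close>
  define z where "z = (1 / sqrt t) *\<^sub>R \<Psi>"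
  have \<Psi>: "\<Psi> = sqrt t *\<^sub>R z" using t by (simp add: z_def)
  have "z \<in> convex hull stab1"
  proof (rule ccontr)
    assume "z \<notin> convex hull stab1"
    then obtain a b where a: "inner a z < b" "\<And>x. x \<in> convex hull stab1 \<Longrightarrow> b < inner a x"
      using separating_hyperplane_closed_point[OF convex_convex_hull
          compact_imp_closed[OF compact_convex_hull[OF compact_stab1]]] by blast
    \<comment> \<open>Phases are free in \<open>stab1\<close>, so \<phi> can be rotated until its
      real inner product with \<open>a\<close> is minus the modulus of the overlap.\<close>
    have le: "cmod (cinner a \<phi>) \<le> - b" if "\<phi> \<in> stab1" for \<phi>
    proof -
      obtain c where c: "cmod c = 1" "c * cinner a \<phi> = cmod (cinner a \<phi>)"
      proof (cases "cinner a \<phi> = 0")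
        case False
        then show ?thesis
          by (intro that[of "cnj (cinner a \<phi>) / cmod (cinner a \<phi>)"])
             (simp_all add: norm_divide mult.commute[of "cnj _"] power2_eq_square flip: complex_norm_square)
      qed (use that[of 1] in simp)
      have "b < inner a ((- c) *s \<phi>)"
        using c that by (intro a(2) hull_inc stab1_scale) auto
      also have "\<dots> = - cmod (cinner a \<phi>)"
        unfolding inner_eq_Re_cinner cinner_scale_right using c(2) by simp
      finally show ?thesis by simp
    qed
    have b: "0 \<le> - b" using le[OF ket_basis_stab1(1)] norm_ge_zero order_trans by blast
    \<comment> \<open>Up to the factor \<open>b\<^sup>2\<close>, the projector on \<open>a\<close>
      is a rank-one witness: bounded on stabilizer projectors, hence by linearity on their
      hull.\<close>
    have "qform a \<tau> \<le> b\<^sup>2" if "\<tau> \<in> mixed_stab1" for \<tau>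
    proof -
      have "convex {\<tau>. qform a \<tau> \<le> b\<^sup>2}"
        using convex_linear_vimage[OF linear_qform convex_real_interval(2)[of "b\<^sup>2"], of a]
        by (simp add: vimage_def)
      moreover have "qform a (outer \<phi> \<phi>) \<le> b\<^sup>2" if "\<phi> \<in> stab1" for \<phi>
        using power_mono[OF le[OF that] norm_ge_zero, of 2] by (simp add: qform_outer_self)
      ultimately have "mixed_stab1 \<subseteq> {\<tau>. qform a \<tau> \<le> b\<^sup>2}"
        unfolding mixed_stab1_def by (intro hull_minimal) auto
      then show ?thesis using that by blast
    qed
    then have "t * qform a \<sigma> \<le> t * b\<^sup>2"
      using \<sigma>(1) t by (intro mult_left_mono) auto
    moreover have "qform a (outer \<Psi> \<Psi>) \<le> t * qform a \<sigma>"
      using psd_qform[OF \<sigma>(2), of a]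
      by (simp add: linear_diff[OF linear_qform] linear_cmul[OF linear_qform])
    ultimately have "(cmod (cinner a \<Psi>))\<^sup>2 \<le> t * b\<^sup>2" by (simp add: qform_outer_self)
    \<comment> \<open>The left side is nonnegative, so squaring keeps the strict inequality and
      contradicts the witness bound for \<Psi>.\<close>
    moreover have "sqrt t * (- b) < cmod (cinner a \<Psi>)"
    proof -
      have "sqrt t * inner a z < sqrt t * b" using a(1) t by simp
      moreover have "sqrt t * inner a z = Re (cinner a \<Psi>)"
        by (simp add: \<Psi> flip: inner_eq_Re_cinner)
      ultimately show ?thesis using abs_Re_le_cmod[of "cinner a \<Psi>"] by simp
    qed
    then have "(sqrt t * (- b))\<^sup>2 < (cmod (cinner a \<Psi>))\<^sup>2"
      using b t by (intro power_strict_mono mult_nonneg_nonneg) auto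
    ultimately show False using t by (simp add: power_mult_distrib)
  qed
  then obtain k :: nat and u x where x: "\<And>i. i \<in> {1..k} \<Longrightarrow> 0 \<le> u i \<and> x i \<in> stab1"
    and u: "sum u {1..k} = 1" and z: "(\<Sum>i = 1..k. u i *\<^sub>R x i) = z"
    unfolding convex_hull_indexed by blast
  have "\<Psi> = (\<Sum>i = 1..k. complex_of_real (sqrt t * u i) *s x i)"
    by (simp add: \<Psi> vec_eq_iff sum_distrib_left scaleR_conv_of_real[where 'a=complex] mult_ac flip: z)
  then have "extent \<Psi> \<le> (\<Sum>i = 1..k. cmod (complex_of_real (sqrt t * u i)))\<^sup>2"
    using x by (intro extent_le) auto
  also have "(\<Sum>i = 1..k. cmod (complex_of_real (sqrt t * u i))) = (\<Sum>i = 1..k. sqrt t * u i)"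
    using x t by (intro sum.cong) (auto simp: norm_mult simp del: of_real_mult)
  also have "\<dots> = sqrt t" using u by (simp flip: sum_distrib_left)
  finally show ?thesis using t by simp
qed

section \<open>The dyadic negativity between generalized robustness and average extent\<close>

text \<open>The definition indexes dyads by natural numbers; enumerating \<open>I\<close> permits
  any finite index set, in particular the triples used below.\<close>

lemma dyadic_negativity_le:
  assumes "finite I" "\<And>i. i \<in> I \<Longrightarrow> L i \<in> stab1 \<and> R i \<in> stab1"
    "\<rho> = (\<Sum>i\<in>I. csmult (\<alpha> i) (outer (L i) (R i)))"
  shows "dyadic_negativity \<rho> \<le> (\<Sum>i\<in>I. cmod (\<alpha> i))"
proof -
  obtain h where h: "bij_betw h {0..<card I} I"
    using ex_bij_betw_nat_finite[OF assms(1)] by blast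
  have eq: "sum f I = (\<Sum>n = 0..<card I. f (h n))" for f :: "_ \<Rightarrow> real"
    by (rule sum.reindex_bij_betw[OF h, symmetric])
  have \<rho>: "\<rho> = (\<Sum>n = 0..<card I. csmult (\<alpha> (h n)) (outer (L (h n)) (R (h n))))"
    unfolding assms(3) by (rule sum.reindex_bij_betw[OF h, symmetric])
  have stab: "\<forall>n\<in>{0..<card I}. L (h n) \<in> stab1 \<and> R (h n) \<in> stab1"
    using assms(2) bij_betwE[OF h] by blast
  show ?thesis
    unfolding dyadic_negativity_def
  proof (rule cInf_lower)
    show "(\<Sum>i\<in>I. cmod (\<alpha> i)) \<in> {(\<Sum>j\<in>J. cmod (\<alpha> j)) | J \<alpha> L R. finite (J :: nat set) \<and>
        (\<forall>j\<in>J. L j \<in> stab1 \<and> R j \<in> stab1) \<and>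
        \<rho> = (\<Sum>j\<in>J. csmult (\<alpha> j) (outer (L j) (R j)))}"
      unfolding eq using stab \<rho> finite_atLeastLessThan[of 0 "card I"]
      by (intro CollectI exI conjI) (rule refl)
  qed (auto intro!: bdd_belowI[of _ 0] sum_nonneg)
qed

lemma sum_Sigma_Times:
  assumes "finite J" "\<And>j. finite (A j)" "\<And>j. finite (B j)"
  shows "sum f (SIGMA j:J. A j \<times> B j) = (\<Sum>j\<in>J. \<Sum>k\<in>A j. \<Sum>l\<in>B j. f (j, k, l))"
proof -
  have "(\<Sum>k\<in>A j. \<Sum>l\<in>B j. f (j, k, l)) = (\<Sum>x\<in>A j \<times> B j. f (j, x))" for j
    unfolding sum.cartesian_product by (simp add: case_prod_unfold)
  then show ?thesis
    using assms by (simp add: sum.Sigma)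
qed

lemma outer_sum:
  "outer (\<Sum>k\<in>K. c k *s \<phi> k) (\<Sum>k\<in>K. c k *s \<phi> k)
     = (\<Sum>k\<in>K. \<Sum>l\<in>K. csmult (c k * cnj (c l)) (outer (\<phi> k) (\<phi> l)))"
  unfolding vec_eq_iff by (simp add: sum_product mult_ac)

text \<open>Expanding both sides of each projector in stabilizer kets gives dyads whose total weight
  is the squared 1-norm of the coefficients. The extent is an infimum, so a slack \<epsilon> is
  carried along.\<close>

lemma dyadic_negativity_le_pure_decomp:
  assumes "pure_decomp \<rho> J p \<Psi>"
  shows "dyadic_negativity \<rho> \<le> (\<Sum>j\<in>J. p j * extent (\<Psi> j))"
proof (rule field_le_epsilon)
  fix \<epsilon> :: real assume "0 < \<epsilon>"
  have J: "finite J" and p: "\<And>j. j \<in> J \<Longrightarrow> 0 < p j" "sum p J = 1"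
    and \<rho>: "\<rho> = (\<Sum>j\<in>J. p j *\<^sub>R outer (\<Psi> j) (\<Psi> j))"
    using assms by (auto simp: pure_decomp_def)
  have "\<exists>K c \<phi>. finite (K :: nat set) \<and> (\<forall>k\<in>K. \<phi> k \<in> stab1) \<and> \<psi> = (\<Sum>k\<in>K. c k *s \<phi> k) \<and>
      (\<Sum>k\<in>K. cmod (c k))\<^sup>2 < extent \<psi> + \<epsilon>" for \<psi>
  proof -
    let ?S = "{(\<Sum>j\<in>J. cmod (c j))\<^sup>2 | J c \<phi>. finite (J :: nat set) \<and>
      (\<forall>j\<in>J. \<phi> j \<in> stab1) \<and> \<psi> = (\<Sum>j\<in>J. c j *s \<phi> j)}"
    \<comment> \<open>The expansion in the computational basis shows that the infimum runs over a
      nonempty set.\<close>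
    let ?c = "\<lambda>k::nat. if k = 0 then \<psi> $ 0 else \<psi> $ 1"
      and ?\<phi> = "\<lambda>k::nat. if k = 0 then ket 1 0 else ket 0 1"
    have "\<psi> = (\<Sum>k\<in>{0, 1}. ?c k *s ?\<phi> k)"
      by (simp add: vec_eq_iff forall_index_2)
    then have "(\<Sum>k\<in>{0, 1}. cmod (?c k))\<^sup>2 \<in> ?S"
      using ket_basis_stab1
      by (intro CollectI exI[of _ "{0, 1}"] exI[of _ ?c] exI[of _ ?\<phi>]) auto
    then have "?S \<noteq> {}" by blast
    then obtain s where "s \<in> ?S" "s < extent \<psi> + \<epsilon>"
      using cInf_lessD[of ?S "extent \<psi> + \<epsilon>"] \<open>0 < \<epsilon>\<close> unfolding extent_def by auto
    then show ?thesis by blast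
  qed
  then have "\<forall>\<psi>. \<exists>K c \<phi>. finite (K :: nat set) \<and> (\<forall>k\<in>K. \<phi> k \<in> stab1) \<and>
      \<psi> = (\<Sum>k\<in>K. c k *s \<phi> k) \<and> (\<Sum>k\<in>K. cmod (c k))\<^sup>2 < extent \<psi> + \<epsilon>"
    by blast
  then obtain K c \<phi> where K: "\<And>\<psi>. finite (K \<psi> :: nat set)" "\<And>\<psi> k. k \<in> K \<psi> \<Longrightarrow> \<phi> \<psi> k \<in> stab1"
    and c: "\<And>\<psi>. \<psi> = (\<Sum>k\<in>K \<psi>. c \<psi> k *s \<phi> \<psi> k)" "\<And>\<psi>. (\<Sum>k\<in>K \<psi>. cmod (c \<psi> k))\<^sup>2 < extent \<psi> + \<epsilon>"
    unfolding choice_iff by blast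
  \<comment> \<open>A triple holds the index of a pure state and those of the left and right kets in
    its chosen expansion.\<close>
  define I where "I = (SIGMA j:J. K (\<Psi> j) \<times> K (\<Psi> j))"
  define \<alpha> where "\<alpha> = (\<lambda>(j, k, l). p j * (c (\<Psi> j) k * cnj (c (\<Psi> j) l)))"
  define L where "L = (\<lambda>(j, k, l :: nat). \<phi> (\<Psi> j) k)"
  define R where "R = (\<lambda>(j, k :: nat, l). \<phi> (\<Psi> j) l)"
  note sum_I = sum_Sigma_Times[OF J, of "\<lambda>j. K (\<Psi> j)" "\<lambda>j. K (\<Psi> j)", OF K(1) K(1), folded I_def]
  have "p j *\<^sub>R outer (\<Psi> j) (\<Psi> j) = (\<Sum>k\<in>K (\<Psi> j). \<Sum>l\<in>K (\<Psi> j).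
      csmult (\<alpha> (j, k, l)) (outer (L (j, k, l)) (R (j, k, l))))" for j
  proof -
    have "p j *\<^sub>R outer (\<Psi> j) (\<Psi> j) = p j *\<^sub>R (\<Sum>k\<in>K (\<Psi> j). \<Sum>l\<in>K (\<Psi> j).
        csmult (c (\<Psi> j) k * cnj (c (\<Psi> j) l)) (outer (\<phi> (\<Psi> j) k) (\<phi> (\<Psi> j) l)))"
      by (simp only: outer_sum[symmetric] c(1)[symmetric])
    also have "\<dots> = (\<Sum>k\<in>K (\<Psi> j). \<Sum>l\<in>K (\<Psi> j).
        csmult (\<alpha> (j, k, l)) (outer (L (j, k, l)) (R (j, k, l))))"
      unfolding scaleR_sum_right \<alpha>_def L_def R_def
      by (intro sum.cong refl) (simp add: vec_eq_iff scaleR_conv_of_real[where 'a=complex] mult_ac)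
    finally show ?thesis .
  qed
  then have "\<rho> = (\<Sum>i\<in>I. csmult (\<alpha> i) (outer (L i) (R i)))"
    unfolding \<rho> sum_I by (intro sum.cong refl)
  moreover have "finite I" using J K(1) by (simp add: I_def)
  ultimately have "dyadic_negativity \<rho> \<le> (\<Sum>i\<in>I. cmod (\<alpha> i))"
    using K(2) by (intro dyadic_negativity_le) (auto simp: I_def L_def R_def)
  also have "\<dots> = (\<Sum>j\<in>J. p j * (\<Sum>k\<in>K (\<Psi> j). cmod (c (\<Psi> j) k))\<^sup>2)"
    unfolding sum_I \<alpha>_def
  proof (intro sum.cong refl)
    fix j assume "j \<in> J"
    then show "(\<Sum>k\<in>K (\<Psi> j). \<Sum>l\<in>K (\<Psi> j).
        cmod (case (j, k, l) of (j, k, l) \<Rightarrow> p j * (c (\<Psi> j) k * cnj (c (\<Psi> j) l))))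
      = p j * (\<Sum>k\<in>K (\<Psi> j). cmod (c (\<Psi> j) k))\<^sup>2"
      unfolding power2_eq_square sum_product
      using p(1)[of j] by (simp add: norm_mult sum_distrib_left)
  qed
  also have "\<dots> \<le> (\<Sum>j\<in>J. p j * (extent (\<Psi> j) + \<epsilon>))"
    using p(1) c(2) by (intro sum_mono mult_left_mono) (auto intro: less_imp_le)
  also have "\<dots> = (\<Sum>j\<in>J. p j * extent (\<Psi> j)) + \<epsilon>"
    by (simp add: distrib_left sum.distrib p(2) flip: sum_distrib_right)
  finally show "dyadic_negativity \<rho> \<le> (\<Sum>j\<in>J. p j * extent (\<Psi> j)) + \<epsilon>" .
qed

text \<open>Each dyad has a real quadratic form at most that of its absolute coefficient times the
  average of the projectors on its two kets; adding these bounds yields a feasible \<sigma>.\<close>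

lemma gen_robustness_le_dyadic:
  assumes "density \<rho>" "finite J" "\<And>j. j \<in> J \<Longrightarrow> L j \<in> stab1 \<and> R j \<in> stab1"
    "\<rho> = (\<Sum>j\<in>J. csmult (\<alpha> j) (outer (L j) (R j)))"
  shows "gen_robustness \<rho> \<le> (\<Sum>j\<in>J. cmod (\<alpha> j))"
proof -
  define t where "t = (\<Sum>j\<in>J. cmod (\<alpha> j))"
  define N where "N j = (1/2) *\<^sub>R outer (L j) (L j) + (1/2) *\<^sub>R outer (R j) (R j)" for j
  define \<sigma> where "\<sigma> = (\<Sum>j\<in>J. (cmod (\<alpha> j) / t) *\<^sub>R N j)"
  \<comment> \<open>The weights of \<sigma> divide by \<open>t\<close>; a vanishing 1-norm would
    contradict unit trace.\<close>
  have "t \<noteq> 0"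
  proof
    assume "t = 0"
    then have "\<alpha> j = 0" if "j \<in> J" for j
      using that assms(2) by (simp add: t_def sum_nonneg_eq_0_iff)
    then have "mtrace \<rho> = 0"
      using assms(4) by (simp add: mtrace_alt)
    then show False using assms(1) by (simp add: density_def)
  qed
  moreover have "0 \<le> t" by (simp add: t_def sum_nonneg)
  ultimately have t: "0 < t" by simp
  have N: "N j \<in> mixed_stab1" if "j \<in> J" for j
    unfolding N_def using assms(3)[OF that]
    by (intro convexD[OF convex_mixed_stab1]) (auto simp: outer_mixed_stab1)
  have \<sigma>: "\<sigma> \<in> mixed_stab1"
    unfolding \<sigma>_def using t N
    by (intro convex_sum[OF assms(2) convex_mixed_stab1])
       (auto simp: sum_divide_distrib[symmetric] t_def)
  have t\<sigma>: "t *\<^sub>R \<sigma> = (\<Sum>j\<in>J. cmod (\<alpha> j) *\<^sub>R N j)"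
    using t by (simp add: \<sigma>_def scaleR_sum_right)
  have "psd (t *\<^sub>R \<sigma> - \<rho>)"
    unfolding psd_iff_qform
  proof (intro conjI allI)
    have "adjoint_op \<sigma> = \<sigma>" "adjoint_op \<rho> = \<rho>"
      using density_mixed_stab1[OF \<sigma>] assms(1) by (auto simp: density_def psd_def)
    then show "adjoint_op (t *\<^sub>R \<sigma> - \<rho>) = t *\<^sub>R \<sigma> - \<rho>"
      by (simp add: adjoint_op_diff adjoint_op_scaleR)
    fix v
    have "qform v (csmult (\<alpha> j) (outer (L j) (R j))) \<le> qform v (cmod (\<alpha> j) *\<^sub>R N j)" for j
    proof -
      let ?l = "cmod (cinner v (L j))" and ?r = "cmod (cinner v (R j))"
      have "csmult (\<alpha> j) (outer (L j) (R j)) = outer (\<alpha> j *s L j) (R j)"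
        by (simp add: vec_eq_iff)
      then have "qform v (csmult (\<alpha> j) (outer (L j) (R j)))
          = Re (\<alpha> j * cinner v (L j) * cnj (cinner v (R j)))"
        by (simp only: qform_outer cinner_scale_right)
      also have "\<dots> \<le> cmod (\<alpha> j) * (?l * ?r)"
        using complex_Re_le_cmod[of "\<alpha> j * cinner v (L j) * cnj (cinner v (R j))"]
        by (simp add: norm_mult mult.assoc)
      \<comment> \<open>Arithmetic-geometric mean inequality for the two overlaps.\<close>
      also have "\<dots> \<le> cmod (\<alpha> j) * ((1/2) * ?l\<^sup>2 + (1/2) * ?r\<^sup>2)"
        using sum_squares_bound[of ?l ?r] by (intro mult_left_mono) auto
      also have "\<dots> = qform v (cmod (\<alpha> j) *\<^sub>R N j)"
        by (simp add: N_def linear_add[OF linear_qform] linear_cmul[OF linear_qform]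
            qform_outer_self del: scaleR_add_right)
      finally show ?thesis .
    qed
    then show "0 \<le> qform v (t *\<^sub>R \<sigma> - \<rho>)"
      unfolding linear_diff[OF linear_qform] t\<sigma> assms(4) linear_sum[OF linear_qform]
      by (simp add: sum_mono)
  qed
  then show ?thesis
    using gen_robustness_attained(2)[OF assms(1) \<sigma>] by (simp add: t_def)
qed

lemma dyadic_decomposition_exists:
  "\<exists>J \<alpha> L R. finite (J :: nat set) \<and> (\<forall>j\<in>J. L j \<in> stab1 \<and> R j \<in> stab1) \<and>
      \<rho> = (\<Sum>j\<in>J. csmult (\<alpha> j) (outer (L j) (R j)))"
proof (intro exI conjI)
  \<comment> \<open>The binary digits of \<open>j\<close> give row and column of a matrix unit, so
    each entry of \<rho> is the coefficient of one dyad.\<close>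
  let ?e = "\<lambda>b. if b then ket 0 1 else ket 1 0"
  show "finite {0, 1, 2, 3 :: nat}" by simp
  show "\<forall>j\<in>{0, 1, 2, 3 :: nat}. ?e (2 \<le> j) \<in> stab1 \<and> ?e (odd j) \<in> stab1"
    using ket_basis_stab1 by simp
  show "\<rho> = (\<Sum>j\<in>{0, 1, 2, 3}. csmult ([\<rho> $ 0 $ 0, \<rho> $ 0 $ 1, \<rho> $ 1 $ 0, \<rho> $ 1 $ 1] ! j)
      (outer (?e (2 \<le> j)) (?e (odd j))))"
    by (simp add: qop_eq_iff)
qed

section \<open>The chain of inequalities closes up\<close>

theorem theorem2:
  fixes \<rho> :: qop
  assumes "density \<rho>"
  shows "gen_robustness \<rho> = dyadic_negativity \<rho> \<and>
         dyadic_negativity \<rho> = mixed_extent \<rho> \<and>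
         equimagical \<rho>"
proof -
  define t where "t = gen_robustness \<rho>"
  obtain J p \<Psi> where dec: "pure_decomp \<rho> J p \<Psi>"
    and feas: "\<forall>j\<in>J. outer (\<Psi> j) (\<Psi> j) \<in> robust_feasible t"
    using robust_feasible_pure_decomp[OF gen_robustness_attained(1)[OF assms]] unfolding t_def .
  have ext: "\<And>j. j \<in> J \<Longrightarrow> extent (\<Psi> j) \<le> t"
    using feas by (simp add: extent_le_of_robust_feasible)
  have J: "finite J" and p: "\<And>j. j \<in> J \<Longrightarrow> 0 < p j" "sum p J = 1"
    using dec by (auto simp: pure_decomp_def)
  let ?D = "{(\<Sum>j\<in>J. cmod (\<alpha> j)) | J \<alpha> L R. finite (J :: nat set) \<and>
      (\<forall>j\<in>J. L j \<in> stab1 \<and> R j \<in> stab1) \<and>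
      \<rho> = (\<Sum>j\<in>J. csmult (\<alpha> j) (outer (L j) (R j)))}"
  have "?D \<noteq> {}"
    using dyadic_decomposition_exists[of \<rho>] by blast
  then have lower: "t \<le> dyadic_negativity \<rho>"
    unfolding dyadic_negativity_def t_def
  proof (rule cInf_greatest)
    fix r assume "r \<in> ?D"
    then obtain J \<alpha> L R where "finite (J :: nat set)" "\<forall>j\<in>J. L j \<in> stab1 \<and> R j \<in> stab1"
      "\<rho> = (\<Sum>j\<in>J. csmult (\<alpha> j) (outer (L j) (R j)))" "r = (\<Sum>j\<in>J. cmod (\<alpha> j))"
      by blast
    then show "gen_robustness \<rho> \<le> r"
      using gen_robustness_le_dyadic[OF assms, of J L R \<alpha>] by simp
  qed
  let ?s = "\<Sum>j\<in>J. p j * extent (\<Psi> j)"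
  have "?s \<le> (\<Sum>j\<in>J. p j * t)"
    using ext p(1) by (intro sum_mono mult_left_mono) (auto intro: less_imp_le)
  also have "\<dots> = t" by (simp add: p(2) flip: sum_distrib_right)
  finally have "?s \<le> t" .
  moreover have "dyadic_negativity \<rho> \<le> ?s"
    by (rule dyadic_negativity_le_pure_decomp[OF dec])
  \<comment> \<open>The average extent is at most \<open>t\<close> and bounds the dyadic negativity,
    which is at least \<open>t\<close>: all three agree.\<close>
  ultimately have s: "?s = t" "dyadic_negativity \<rho> = t" using lower by auto
  have "mixed_extent \<rho> = t"
    unfolding mixed_extent_def
  proof (rule cInf_eq_minimum)
    show "t \<in> {(\<Sum>j\<in>J. p j * extent (\<Psi> j)) | J p \<Psi>. pure_decomp \<rho> J p \<Psi>}"
      using dec s(1) by blast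
  next
    fix r assume "r \<in> {(\<Sum>j\<in>J. p j * extent (\<Psi> j)) | J p \<Psi>. pure_decomp \<rho> J p \<Psi>}"
    then show "t \<le> r"
      using dyadic_negativity_le_pure_decomp unfolding s(2)[symmetric] by blast
  qed
  \<comment> \<open>The deficits \<open>t - extent (\<Psi> j)\<close> are nonnegative and average to
    zero under strictly positive weights, so each vanishes.\<close>
  moreover have "extent (\<Psi> j) = t" if "j \<in> J" for j
  proof -
    have "(\<Sum>j\<in>J. p j * (t - extent (\<Psi> j))) = 0"
      using s(1) by (simp add: right_diff_distrib sum_subtractf p(2) flip: sum_distrib_right)
    moreover have "\<And>j. j \<in> J \<Longrightarrow> 0 \<le> p j * (t - extent (\<Psi> j))"
      using ext p(1) by (simp add: less_imp_le)
    ultimately have "p j * (t - extent (\<Psi> j)) = 0"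
      using that sum_nonneg_eq_0_iff[OF J, of "\<lambda>j. p j * (t - extent (\<Psi> j))"] by simp
    then show ?thesis using p(1)[OF that] by simp
  qed
  ultimately have "equimagical \<rho>"
    unfolding equimagical_def using dec s(1)
    by (intro exI[of _ J] exI[of _ p] exI[of _ \<Psi>]) simp
  then show ?thesis
    using s(2) \<open>mixed_extent \<rho> = t\<close> by (simp add: t_def)
qed

end
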